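(* Let $V_N=(v_N(1),\dots,v_N(B_N))$, $N=1,2,3,\dots$, be finite sequences of elements of $[0,1]$ with $B_N\to\infty$, and let $\omega_N$ be the periodic sequence defined by $\omega_N(n)=v_N(j)$ iff $n\equiv j\pmod{B_N}$, $j\in\{1,\dots,B_N\}$, $n\in\mathbb N$. Suppose that $\omega_N$ converges almost uniformly to a sequence $\omega$ as $N\to\infty$. Then the system $V_N$, $N=1,2,3,\dots$, is uniformly distributed if and only if the sequence $\omega$ is Buck uniformly distributed.
   Context: The system $V_N$ is uniformly distributed if $\lim_{N\to\infty}\frac1{B_N}\sum_{n=1}^{B_N}f(v_N(n))=\int_0^1f(x)\,dx$ for every continuous $f$ on $[0,1]$ (equivalently $\lim_{N\to\infty}\frac1{B_N}|\{n\le B_N: v_N(n)<x\}|=x$ for every $x\in[0,1]$). For $m\in\mathbb N$, $r\ge0$ let $r+(m)=\{n\in\mathbb N:n\equiv r\pmod m\}$; Buck's measure density is $\mu^\ast(A)=\inf\{\sum_{j=1}^k\frac1{m_j}:A\subset\bigcup_{j=1}^k(r_j+(m_j))\}$; $A$ is Buck measurable if $\mu^\ast(A)+\mu^\ast(\mathbb N\setminus A)=1$, and $\mu=\mu^\ast$ on such sets. $\omega_N\to\omega$ almost uniformly means: for every $\delta>0$ there is a Buck measurable $S$ with $\mu(S)<\delta$ such that $\omega_N\to\omega$ uniformly on $\mathbb N\setminus S$. A sequence $\omega$ in $[0,1]$ is Buck uniformly distributed if for each $x\in[0,1]$ the set $\{n:\omega(n)<x\}$ is Buck measurable with $\mu$-measure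 $x$. *)

theory Defs
  imports "HOL-Analysis.Analysis" "HOL-Number_Theory.Cong"
begin

text \<open>
  The positive integers are the set \<open>{1..}\<close> of natural numbers. Sequences are functions on
  \<^typ>\<open>nat\<close> whose value at 0 is never used.
\<close>

definition arith_prog :: "nat \<Rightarrow> nat \<Rightarrow> nat set" where
  "arith_prog r m = {n \<in> {1..}. [n = r] (mod m)}"

definition buck_density :: "nat set \<Rightarrow> real" where
  "buck_density A =
     Inf {(\<Sum>j=1..k. 1 / real (m j)) | (k :: nat) (r :: nat \<Rightarrow> nat) (m :: nat \<Rightarrow> nat).
            (\<forall>j\<in>{1..k}. m j \<ge> 1) \<and> A \<subseteq> (\<Union>j\<in>{1..k}. arith_prog (r j) (m j))}"

text \<open>
  On Buck measurable sets the Buck measure is by definition the restriction of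
  \<^const>\<open>buck_density\<close>, so no separate constant is introduced for it.
\<close>

definition buck_measurable :: "nat set \<Rightarrow> bool" where
  "buck_measurable A \<longleftrightarrow> A \<subseteq> {1..} \<and> buck_density A + buck_density ({1..} - A) = 1"

definition almost_uniform_limit :: "(nat \<Rightarrow> nat \<Rightarrow> real) \<Rightarrow> (nat \<Rightarrow> real) \<Rightarrow> bool" where
  "almost_uniform_limit W \<omega> \<longleftrightarrow>
     (\<forall>\<delta>>0. \<exists>S. buck_measurable S \<and> buck_density S < \<delta> \<and>
        uniform_limit ({1..} - S) W \<omega> sequentially)"

text \<open>
  The finite sequence of length \<open>b\<close> is given by the values \<open>v 1, \<dots>, v b\<close>; for \<open>b \<ge> 1\<close>
  the index \<open>j\<close> below exists and is unique.
\<close>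

definition periodic_extension :: "nat \<Rightarrow> (nat \<Rightarrow> real) \<Rightarrow> nat \<Rightarrow> real" where
  "periodic_extension b v n = v (THE j. j \<in> {1..b} \<and> [n = j] (mod b))"

definition uniformly_distributed_system :: "(nat \<Rightarrow> nat) \<Rightarrow> (nat \<Rightarrow> nat \<Rightarrow> real) \<Rightarrow> bool" where
  "uniformly_distributed_system B v \<longleftrightarrow>
     (\<forall>f :: real \<Rightarrow> real. continuous_on {0..1} f \<longrightarrow>
        (\<lambda>N. 1 / real (B N) * (\<Sum>n=1..B N. f (v N n))) \<longlonglongrightarrow> integral {0..1} f)"

definition buck_uniformly_distributed :: "(nat \<Rightarrow> real) \<Rightarrow> bool" where
  "buck_uniformly_distributed \<omega> \<longleftrightarrow>
     (\<forall>x\<in>{0..1}. buck_measurable {n \<in> {1..}. \<omega> n < x} \<and>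
        buck_density {n \<in> {1..}. \<omega> n < x} = x)"

end

theory Submission
  imports Defs
begin

text \<open>
  Replacing \<open>\<omega>\<close> by the periodic approximant \<open>\<omega>\<^sub>N\<close> costs a shift \<open>\<epsilon>\<close> of the level and a set of
  density \<open>\<epsilon>\<close>, and a set that is periodic modulo \<open>B N\<close> has Buck density at most its relative
  frequency in one period. So with \<open>F\<^sub>N\<close> the empirical distribution function of \<open>V\<^sub>N\<close>, for large
  \<open>N\<close> the density of \<open>{\<omega> < x - \<epsilon>}\<close> is at most \<open>F\<^sub>N x + \<epsilon>\<close> and that of \<open>{\<omega> \<ge> x + \<epsilon>}\<close> at most
  \<open>1 - F\<^sub>N x + \<epsilon>\<close>. Since the densities of a set and of its complement add up to at least 1, these
  two upper bounds give both implications; lower bounds for densities of periodic sets are never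
  needed.
\<close>

section \<open>Buck's measure density\<close>

lemma buck_density_bdd_below:
  "bdd_below {(\<Sum>j=1..k. 1 / real (m j)) | (k :: nat) (r :: nat \<Rightarrow> nat) (m :: nat \<Rightarrow> nat).
            (\<forall>j\<in>{1..k}. m j \<ge> 1) \<and> A \<subseteq> (\<Union>j\<in>{1..k}. arith_prog (r j) (m j))}"
  by (rule bdd_belowI[of _ 0]) (auto intro!: sum_nonneg)

text \<open>Frees covers from the index set \<open>{1..k}\<close> of the definition: below they are
  indexed by disjoint sums and by sets of residues.\<close>

lemma buck_density_le_sum:
  fixes r m :: "'i \<Rightarrow> nat"
  assumes "finite I" "\<And>i. i \<in> I \<Longrightarrow> m i \<ge> 1" "A \<subseteq> (\<Union>i\<in>I. arith_prog (r i) (m i))"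
  shows "buck_density A \<le> (\<Sum>i\<in>I. 1 / real (m i))"
proof -
  obtain h where h: "bij_betw h {1..card I} I"
    using ex_bij_betw_nat_finite_1[OF assms(1)] by blast
  have img: "h ` {1..card I} = I"
    using h by (simp add: bij_betw_def)
  have eq: "(\<Sum>i\<in>I. 1 / real (m i)) = (\<Sum>j=1..card I. 1 / real ((m \<circ> h) j))"
    using sum.reindex_bij_betw[OF h, of "\<lambda>i. 1 / real (m i)"] by simp
  have cov: "A \<subseteq> (\<Union>j\<in>{1..card I}. arith_prog ((r \<circ> h) j) ((m \<circ> h) j))"
  proof
    fix n assume "n \<in> A"
    then obtain i where "i \<in> I" "n \<in> arith_prog (r i) (m i)"
      using assms(3) by blast
    moreover from this obtain j where "j \<in> {1..card I}" "i = h j"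
      using img by blast
    ultimately show "n \<in> (\<Union>j\<in>{1..card I}. arith_prog ((r \<circ> h) j) ((m \<circ> h) j))"
      by auto
  qed
  have pos: "\<forall>j\<in>{1..card I}. (m \<circ> h) j \<ge> 1"
    using assms(2) img by auto
  show ?thesis
    unfolding buck_density_def eq
    using cov pos
    by (intro cInf_lower[OF _ buck_density_bdd_below] CollectI exI[of _ "card I"]
        exI[of _ "r \<circ> h"] exI[of _ "m \<circ> h"] conjI refl)
qed

lemma buck_density_cover:
  assumes "A \<subseteq> {1..}" "e > 0"
  obtains k :: nat and r m :: "nat \<Rightarrow> nat" where
    "\<forall>j\<in>{1..k}. m j \<ge> 1" "A \<subseteq> (\<Union>j\<in>{1..k}. arith_prog (r j) (m j))"
    "(\<Sum>j=1..k. 1 / real (m j)) < buck_density A + e"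
proof -
  let ?X = "{(\<Sum>j=1..k. 1 / real (m j)) | (k :: nat) (r :: nat \<Rightarrow> nat) (m :: nat \<Rightarrow> nat).
            (\<forall>j\<in>{1..k}. m j \<ge> 1) \<and> A \<subseteq> (\<Union>j\<in>{1..k}. arith_prog (r j) (m j))}"
  \<comment> \<open>No \<open>arith_prog\<close> contains 0, so it is
    \<open>A \<subseteq> {1..}\<close> that makes covers exist; otherwise \<open>Inf\<close> would
    be taken over the empty set.\<close>
  have "A \<subseteq> (\<Union>j\<in>{1..1::nat}. arith_prog 0 1)"
    using assms(1) by (auto simp: arith_prog_def cong_def)
  then have "(\<Sum>j=1..1::nat. 1 / real 1) \<in> ?X"
    by (intro CollectI exI[of _ "1::nat"] exI[of _ "\<lambda>_. 0"] exI[of _ "\<lambda>_. 1"]) auto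
  then have ne: "?X \<noteq> {}"
    by blast
  have "Inf ?X < buck_density A + e"
    using assms(2) by (simp add: buck_density_def)
  from cInf_lessD[OF ne this] obtain s where s: "s \<in> ?X" "s < buck_density A + e"
    by (elim bexE)
  from s(1) obtain k :: nat and r m :: "nat \<Rightarrow> nat" where
    "s = (\<Sum>j=1..k. 1 / real (m j))" "\<forall>j\<in>{1..k}. m j \<ge> 1"
    "A \<subseteq> (\<Union>j\<in>{1..k}. arith_prog (r j) (m j))"
    by (elim CollectE exE conjE)
  then show thesis
    using s(2) by (intro that[of k m r]) simp_all
qed

lemma buck_density_mono:
  assumes "A \<subseteq> C" "C \<subseteq> {1..}"
  shows "buck_density A \<le> buck_density C"
proof (rule field_le_epsilon)
  fix e :: real assume "e > 0"
  obtain k :: nat and r m :: "nat \<Rightarrow> nat" where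
    c: "\<forall>j\<in>{1..k}. m j \<ge> 1" "C \<subseteq> (\<Union>j\<in>{1..k}. arith_prog (r j) (m j))"
    "(\<Sum>j=1..k. 1 / real (m j)) < buck_density C + e"
    by (rule buck_density_cover[OF assms(2) \<open>e > 0\<close>]) (rule that)
  have "buck_density A \<le> (\<Sum>j=1..k. 1 / real (m j))"
    by (rule buck_density_le_sum) (use c assms in auto)
  then show "buck_density A \<le> buck_density C + e"
    using c by simp
qed

lemma buck_density_Un_le:
  assumes "A \<subseteq> {1..}" "C \<subseteq> {1..}"
  shows "buck_density (A \<union> C) \<le> buck_density A + buck_density C"
proof (rule field_le_epsilon)
  fix e :: real assume "e > 0"
  then have e2: "e / 2 > 0" by simp
  obtain k :: nat and r m :: "nat \<Rightarrow> nat" where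
    a: "\<forall>j\<in>{1..k}. m j \<ge> 1" "A \<subseteq> (\<Union>j\<in>{1..k}. arith_prog (r j) (m j))"
    "(\<Sum>j=1..k. 1 / real (m j)) < buck_density A + e / 2"
    by (rule buck_density_cover[OF assms(1) e2]) (rule that)
  obtain k' :: nat and r' m' :: "nat \<Rightarrow> nat" where
    c: "\<forall>j\<in>{1..k'}. m' j \<ge> 1" "C \<subseteq> (\<Union>j\<in>{1..k'}. arith_prog (r' j) (m' j))"
    "(\<Sum>j=1..k'. 1 / real (m' j)) < buck_density C + e / 2"
    by (rule buck_density_cover[OF assms(2) e2]) (rule that)
  \<comment> \<open>The two covers are placed side by side on a disjoint sum, so no indices have to
    be shifted.\<close>
  let ?I = "{1..k} <+> {1..k'}" and ?r = "case_sum r r'" and ?m = "case_sum m m'"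
  have "A \<union> C \<subseteq> (\<Union>i\<in>?I. arith_prog (?r i) (?m i))"
    using a(2) c(2) by (fastforce simp: Plus_def)
  then have "buck_density (A \<union> C) \<le> (\<Sum>i\<in>?I. 1 / real (?m i))"
    by (rule buck_density_le_sum[rotated 2]) (use a(1) c(1) in auto)
  also have "\<dots> = (\<Sum>j=1..k. 1 / real (m j)) + (\<Sum>j=1..k'. 1 / real (m' j))"
    by (simp add: sum.Plus)
  finally show "buck_density (A \<union> C) \<le> buck_density A + buck_density C + e"
    using a(3) c(3) by simp
qed

text \<open>Cut \<open>{1..q * m}\<close> into \<open>q\<close> blocks of \<open>m\<close>
  consecutive integers. The number of the block of \<open>n\<close> is \<open>(n - 1) div m\<close>,
  and a residue class meets each block at most once.\<close>

lemma card_arith_prog_le: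
  assumes "m \<ge> 1"
  shows "card (arith_prog r m \<inter> {1..q * m}) \<le> q"
proof -
  let ?X = "arith_prog r m \<inter> {1..q * m}"
  have "inj_on (\<lambda>n. (n - 1) div m) ?X"
  proof (rule inj_onI)
    fix a b assume ab: "a \<in> ?X" "b \<in> ?X" "(a - 1) div m = (b - 1) div m"
    then have "[a = b] (mod m)"
      by (auto simp: arith_prog_def cong_def)
    moreover have "a = Suc (a - 1)" "b = Suc (b - 1)"
      using ab by auto
    ultimately have "[a - 1 = b - 1] (mod m)"
      by (metis cong_add_rcancel_nat Suc_eq_plus1)
    then have "a - 1 = b - 1"
      using ab(3) by (metis cong_def div_mult_mod_eq)
    then show "a = b"
      using ab by auto
  qed
  moreover have "(\<lambda>n. (n - 1) div m) ` ?X \<subseteq> {..<q}"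
    using assms by (auto simp: less_mult_imp_div_less)
  ultimately have "card ?X \<le> card {..<q}"
    by (meson card_inj_on_le finite_lessThan)
  then show ?thesis by simp
qed

text \<open>Counting over a common period \<open>M\<close> of all moduli: the class modulo
  \<open>m j\<close> has at most \<open>M div m j\<close> members in \<open>{1..M}\<close>, so
  covering all \<open>M\<close> points forces the reciprocals of the moduli to sum to at least
  1.\<close>

lemma buck_density_atLeast1_ge: "1 \<le> buck_density {1..}"
proof (rule field_le_epsilon)
  fix e :: real assume "e > 0"
  obtain k :: nat and r m :: "nat \<Rightarrow> nat" where
    c: "\<forall>j\<in>{1..k}. m j \<ge> 1" "{1..} \<subseteq> (\<Union>j\<in>{1..k}. arith_prog (r j) (m j))"
    "(\<Sum>j=1..k. 1 / real (m j)) < buck_density {1..} + e"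
    by (rule buck_density_cover[OF subset_refl \<open>e > 0\<close>]) (rule that)
  define M where "M = (\<Prod>j=1..k. m j)"
  have M: "M > 0"
    unfolding M_def using c(1) by (intro prod_pos) fastforce
  have "M = card {1..M}" by simp
  also have "\<dots> \<le> card (\<Union>j\<in>{1..k}. arith_prog (r j) (m j) \<inter> {1..M})"
    by (rule card_mono) (use c(2) in auto)
  also have "\<dots> \<le> (\<Sum>j=1..k. card (arith_prog (r j) (m j) \<inter> {1..M}))"
    by (rule card_UN_le) simp
  also have "\<dots> \<le> (\<Sum>j=1..k. M div m j)"
  proof (rule sum_mono)
    fix j assume j: "j \<in> {1..k}"
    then have "m j dvd M"
      unfolding M_def by (intro dvd_prodI) auto
    then show "card (arith_prog (r j) (m j) \<inter> {1..M}) \<le> M div m j"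
      using card_arith_prog_le[OF c(1)[rule_format, OF j], of "r j" "M div m j"] by simp
  qed
  finally have "real M \<le> (\<Sum>j=1..k. real (M div m j))"
    by (metis of_nat_le_iff of_nat_sum)
  also have "\<dots> \<le> (\<Sum>j=1..k. real M * (1 / real (m j)))"
    by (rule sum_mono) (simp add: of_nat_div_le_of_nat)
  also have "\<dots> = real M * (\<Sum>j=1..k. 1 / real (m j))"
    by (simp add: sum_distrib_left)
  finally have "1 \<le> (\<Sum>j=1..k. 1 / real (m j))"
    using M by simp
  then show "1 \<le> buck_density {1..} + e"
    using c(3) by simp
qed

lemma buck_density_complement_ge:
  assumes "A \<subseteq> {1..}"
  shows "1 \<le> buck_density A + buck_density ({1..} - A)"
proof -
  have "A \<union> ({1..} - A) = {1..}"
    using assms by auto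
  then show ?thesis
    using buck_density_atLeast1_ge buck_density_Un_le[OF assms Diff_subset[of "{1..}" A]] by simp
qed

section \<open>Periodic extensions of finite sequences\<close>

lemma periodic_extension_cong:
  assumes "j \<in> {1..b}" "[n = j] (mod b)"
  shows "periodic_extension b v n = v j"
proof -
  have "(THE j. j \<in> {1..b} \<and> [n = j] (mod b)) = j"
  proof (rule the_equality)
    fix i assume i: "i \<in> {1..b} \<and> [n = i] (mod b)"
    then have "[i = j] (mod b)"
      using assms by (auto simp: cong_def)
    \<comment> \<open>Representatives run through \<open>1..b\<close>; shifted down by one they lie
      below \<open>b\<close>, where congruence is equality.\<close>
    moreover have "i = Suc (i - 1)" "j = Suc (j - 1)"
      using i assms by auto
    ultimately have "[i - 1 = j - 1] (mod b)"
      by (metis cong_add_rcancel_nat Suc_eq_plus1)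
    moreover have "i - 1 < b" "j - 1 < b"
      using i assms by auto
    ultimately have "i - 1 = j - 1"
      by (simp add: cong_def)
    then show "i = j"
      using i assms by auto
  qed (use assms in auto)
  then show ?thesis
    by (simp add: periodic_extension_def)
qed

lemma ex_residue_atLeast1:
  assumes "(b :: nat) \<ge> 1"
  obtains j where "j \<in> {1..b}" "[n = j] (mod b)"
proof (cases "n mod b = 0")
  \<comment> \<open>The zero class is represented by \<open>b\<close> itself.\<close>
  case True
  then show thesis
    using that[of b] assms by (auto simp: cong_def)
next
  case False
  moreover have "n mod b < b"
    using assms by simp
  ultimately show thesis
    using that[of "n mod b"] by (auto simp: cong_def)
qed

text \<open>One residue class modulo \<open>b\<close> for each index \<open>j\<close> with
  \<open>P (v j)\<close> covers the set, at cost \<open>1 / b\<close> each.\<close>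

lemma buck_density_periodic_le:
  assumes "b \<ge> 1"
  shows "buck_density {n \<in> {1..}. P (periodic_extension b v n)}
           \<le> real (card {j \<in> {1..b}. P (v j)}) / real b"
proof -
  let ?J = "{j \<in> {1..b}. P (v j)}"
  have "{n \<in> {1..}. P (periodic_extension b v n)} \<subseteq> (\<Union>j\<in>?J. arith_prog j b)"
  proof
    fix n assume n: "n \<in> {n \<in> {1..}. P (periodic_extension b v n)}"
    obtain j where j: "j \<in> {1..b}" "[n = j] (mod b)"
      using ex_residue_atLeast1[OF assms] .
    then show "n \<in> (\<Union>j\<in>?J. arith_prog j b)"
      using n periodic_extension_cong[OF j, of v] by (auto simp: arith_prog_def)
  qed
  then have "buck_density {n \<in> {1..}. P (periodic_extension b v n)} \<le> (\<Sum>j\<in>?J. 1 / real b)"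
    by (rule buck_density_le_sum[rotated 2]) (use assms in auto)
  then show ?thesis by simp
qed

section \<open>Distribution functions\<close>

definition empirical_cdf :: "nat \<Rightarrow> (nat \<Rightarrow> real) \<Rightarrow> real \<Rightarrow> real" where
  "empirical_cdf b u x = real (card {j \<in> {1..b}. u j < x}) / real b"

definition mean :: "nat \<Rightarrow> (nat \<Rightarrow> real) \<Rightarrow> (real \<Rightarrow> real) \<Rightarrow> real" where
  "mean b u f = 1 / real b * (\<Sum>n=1..b. f (u n))"

lemma empirical_cdf_nonneg: "0 \<le> empirical_cdf b u x"
  by (simp add: empirical_cdf_def)

lemma empirical_cdf_le_1: "empirical_cdf b u x \<le> 1"
proof -
  have "card {j \<in> {1..b}. u j < x} \<le> card {1..b}"
    by (rule card_mono) auto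
  then show ?thesis
    by (cases "b = 0") (simp_all add: empirical_cdf_def)
qed

lemma empirical_cdf_complement:
  assumes "b \<ge> 1"
  shows "real (card {j \<in> {1..b}. x \<le> u j}) / real b = 1 - empirical_cdf b u x"
proof -
  have "card ({j \<in> {1..b}. u j < x} \<union> {j \<in> {1..b}. x \<le> u j})
      = card {j \<in> {1..b}. u j < x} + card {j \<in> {1..b}. x \<le> u j}"
    by (rule card_Un_disjoint) auto
  moreover have "{j \<in> {1..b}. u j < x} \<union> {j \<in> {1..b}. x \<le> u j} = {1..b}"
    by auto
  ultimately have "real b = real (card {j \<in> {1..b}. u j < x}) + real (card {j \<in> {1..b}. x \<le> u j})"
    by (metis card_atLeastAtMost diff_Suc_1 of_nat_add)
  then show ?thesis
    using assms by (simp add: empirical_cdf_def field_simps)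
qed

text \<open>Makes monotonicity and linearity of \<open>mean\<close> available for distribution
  functions, which can then be compared with averages of continuous functions.\<close>

lemma empirical_cdf_eq_mean: "empirical_cdf b u x = mean b u (\<lambda>t. of_bool (t < x))"
proof -
  have "(\<Sum>n=1..b. of_bool (u n < x) :: real) = real (card ({1..b} \<inter> {j. u j < x}))"
    by simp
  also have "{1..b} \<inter> {j. u j < x} = {j \<in> {1..b}. u j < x}"
    by auto
  finally show ?thesis
    by (simp add: empirical_cdf_def mean_def)
qed

lemma mean_mono:
  assumes "\<And>n. n \<in> {1..b} \<Longrightarrow> f (u n) \<le> g (u n)"
  shows "mean b u f \<le> mean b u g"
  unfolding mean_def by (intro mult_left_mono sum_mono assms) auto

lemma mean_add: "mean b u (\<lambda>t. f t + g t) = mean b u f + mean b u g"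
  by (simp add: mean_def sum.distrib algebra_simps)

lemma mean_cmult: "mean b u (\<lambda>t. c * f t) = c * mean b u f"
  by (simp add: mean_def sum_distrib_left algebra_simps)

lemma mean_sum: "mean b u (\<lambda>t. \<Sum>i\<in>I. f i t) = (\<Sum>i\<in>I. mean b u (f i))"
  unfolding mean_def by (subst sum.swap) (simp add: sum_distrib_left)

lemma mean_const: "b \<ge> 1 \<Longrightarrow> mean b u (\<lambda>_. c) = c"
  by (simp add: mean_def)

lemma mean_diff_le:
  assumes "b \<ge> 1" "\<And>n. n \<in> {1..b} \<Longrightarrow> \<bar>f (u n) - g (u n)\<bar> \<le> e"
  shows "\<bar>mean b u f - mean b u g\<bar> \<le> e"
proof -
  have "mean b u f \<le> mean b u (\<lambda>t. g t + e)" "mean b u g \<le> mean b u (\<lambda>t. f t + e)"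
    by (rule mean_mono; use assms(2) in force)+
  then show ?thesis
    using assms(1) by (simp add: mean_add mean_const)
qed

text \<open>A continuous ramp between the indicator functions of \<open>t \<le> y\<close> and \<open>t < y + e\<close>.\<close>

definition ramp :: "real \<Rightarrow> real \<Rightarrow> real \<Rightarrow> real" where
  "ramp y e t = max 0 (min 1 ((y + e - t) / e))"

lemma continuous_on_ramp: "e > 0 \<Longrightarrow> continuous_on S (ramp y e)"
  unfolding ramp_def by (intro continuous_intros) auto

lemma ramp_bounds: "0 \<le> ramp y e t" "ramp y e t \<le> 1"
  by (auto simp: ramp_def)

lemma ramp_eq_1: "e > 0 \<Longrightarrow> t \<le> y \<Longrightarrow> ramp y e t = 1"
  by (auto simp: ramp_def field_simps)

lemma ramp_eq_0: "e > 0 \<Longrightarrow> y + e \<le> t \<Longrightarrow> ramp y e t = 0"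
  by (auto simp: ramp_def divide_nonpos_pos)

section \<open>Integrals of indicators and ramps\<close>

lemma has_integral_of_bool_atMost:
  assumes "c \<in> {0..1}"
  shows "((\<lambda>t. of_bool (t \<le> c)) has_integral c) {0..1::real}"
proof -
  have "((\<lambda>t. 1) has_integral c) {0..c}"
    using has_integral_const_real[of "1::real" 0 c] assms by simp
  then have "((\<lambda>t. if t \<in> {0..c} then 1 else 0) has_integral c) {0..1}"
    by (subst has_integral_restrict) (use assms in auto)
  then show ?thesis
    by (rule has_integral_eq[rotated]) auto
qed

lemma has_integral_of_bool_atLeast:
  assumes "c \<in> {0..1}"
  shows "((\<lambda>t. of_bool (c \<le> t)) has_integral 1 - c) {0..1::real}"
proof -
  have "((\<lambda>t. 1) has_integral 1 - c) {c..1}"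
    using has_integral_const_real[of "1::real" c 1] assms by simp
  then have "((\<lambda>t. if t \<in> {c..1} then 1 else 0) has_integral 1 - c) {0..1}"
    by (subst has_integral_restrict) (use assms in auto)
  then show ?thesis
    by (rule has_integral_eq[rotated]) auto
qed

lemma integral_ramp_le:
  assumes "e > 0" "y \<ge> 0"
  shows "integral {0..1} (ramp y e) \<le> y + e"
proof -
  \<comment> \<open>The cap moves the jump of the dominating indicator into the interval of
    integration without changing that indicator there.\<close>
  have c: "min 1 (y + e) \<in> {0..1}"
    using assms by auto
  have "integral {0..1} (ramp y e) \<le> min 1 (y + e)"
  proof (rule has_integral_le[OF integrable_integral has_integral_of_bool_atMost[OF c]])
    show "ramp y e integrable_on {0..1}"
      using assms by (intro integrable_continuous_real continuous_on_ramp)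
    show "ramp y e t \<le> of_bool (t \<le> min 1 (y + e))" if "t \<in> {0..1}" for t
      using that assms ramp_bounds[of y e t] ramp_eq_0[of e y t] by (auto split: if_splits)
  qed
  then show ?thesis by simp
qed

lemma integral_ramp_ge:
  assumes "e > 0" "y \<le> 1"
  shows "y \<le> integral {0..1} (ramp y e)"
proof -
  have c: "max 0 y \<in> {0..1}"
    using assms by auto
  have int: "ramp y e integrable_on {0..1}"
    using assms by (intro integrable_continuous_real continuous_on_ramp)
  show ?thesis
  proof (cases "y \<ge> 0")
    case True
    then show ?thesis
      using assms ramp_bounds ramp_eq_1[of e]
      by (intro has_integral_le[OF has_integral_of_bool_atMost integrable_integral[OF int]]) auto
  next
    case False
    then show ?thesis
      using integral_nonneg[OF int] ramp_bounds(1)[of y e] by force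
  qed
qed

text \<open>The indicator of \<open>t < x\<close> is squeezed between the ramps falling on
  \<open>[x - e/2, x]\<close> and on \<open>[x, x + e/2]\<close>. Their integrals are within
  \<open>e / 2\<close> of \<open>x\<close>, which leaves room for the convergence of the
  means.\<close>

lemma uniformly_distributed_system_imp_cdf:
  assumes "uniformly_distributed_system B v" "x \<in> {0..1}"
  shows "(\<lambda>N. empirical_cdf (B N) (v N) x) \<longlonglongrightarrow> x"
proof (rule tendstoI)
  fix e :: real assume e: "e > 0"
  then have e2: "e / 2 > 0" by simp
  have lim: "(\<lambda>N. mean (B N) (v N) (ramp y (e / 2))) \<longlonglongrightarrow> integral {0..1} (ramp y (e / 2))" for y
    using assms(1) continuous_on_ramp[OF e2]
    by (simp add: uniformly_distributed_system_def mean_def)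
  have "integral {0..1} (ramp x (e / 2)) < x + e"
    using integral_ramp_le[OF e2, of x] assms(2) e by simp
  from order_tendstoD(2)[OF lim this]
  have up: "\<forall>\<^sub>F N in sequentially. mean (B N) (v N) (ramp x (e / 2)) < x + e" .
  have "x - e < integral {0..1} (ramp (x - e / 2) (e / 2))"
    using integral_ramp_ge[OF e2, of "x - e / 2"] assms(2) e by simp
  from order_tendstoD(1)[OF lim this]
  have lo: "\<forall>\<^sub>F N in sequentially. x - e < mean (B N) (v N) (ramp (x - e / 2) (e / 2))" .
  show "\<forall>\<^sub>F N in sequentially. dist (empirical_cdf (B N) (v N) x) x < e"
    using up lo
  proof eventually_elim
    case (elim N)
    have "empirical_cdf (B N) (v N) x \<le> mean (B N) (v N) (ramp x (e / 2))"
      unfolding empirical_cdf_eq_mean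
      using ramp_eq_1[OF e2, of _ x] ramp_bounds(1) by (intro mean_mono) auto
    moreover have "mean (B N) (v N) (ramp (x - e / 2) (e / 2)) \<le> empirical_cdf (B N) (v N) x"
      unfolding empirical_cdf_eq_mean
      using ramp_eq_0[OF e2, of "x - e / 2"] ramp_bounds(2) by (intro mean_mono) auto
    ultimately show ?case
      using elim by (simp add: dist_real_def abs_less_iff)
  qed
qed

text \<open>The grid approximation of \<open>f\<close> in summed-by-parts form: a combination of
  indicators of \<open>c \<le> t\<close>, whose means are complements of values of
  \<open>empirical_cdf\<close>.\<close>

definition step_approx :: "(real \<Rightarrow> real) \<Rightarrow> nat \<Rightarrow> real \<Rightarrow> real" where
  "step_approx f K t =
     f 0 + (\<Sum>i=1..K. (f (real i / real K) - f (real (i - 1) / real K)) * of_bool (real i / real K \<le> t))"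

text \<open>Exactly the jumps with \<open>i \<le> \<lfloor>t * real K\<rfloor>\<close> are switched
  on, and their sum telescopes.\<close>

lemma step_approx_eq:
  assumes "K \<ge> 1" "t \<in> {0..1}"
  shows "step_approx f K t = f (real (nat \<lfloor>t * real K\<rfloor>) / real K)"
proof -
  define j where "j = nat \<lfloor>t * real K\<rfloor>"
  have K: "real K > 0"
    using assms by simp
  have "t * real K \<le> 1 * real K"
    using assms by (intro mult_right_mono) auto
  then have "j \<le> K"
    unfolding j_def by linarith
  have iff: "real i / real K \<le> t \<longleftrightarrow> i \<le> j" for i
    unfolding j_def using K assms by (simp add: le_nat_floor divide_le_eq le_floor_iff nat_le_iff
      le_nat_iff)
  have "step_approx f K t
      = f 0 + (\<Sum>i\<in>{1..K}. if i \<in> {1..j} then f (real i / real K) - f (real (i - 1) / real K) else 0)"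
    unfolding step_approx_def by (intro arg_cong2[where f = "(+)"] sum.cong) (auto simp: iff)
  also have "\<dots> = f 0 + (\<Sum>i\<in>{1..K} \<inter> {1..j}. f (real i / real K) - f (real (i - 1) / real K))"
    by (subst sum.inter_restrict) auto
  also have "{1..K} \<inter> {1..j} = {Suc 0..j}"
    using \<open>j \<le> K\<close> by auto
  also have "f 0 + (\<Sum>i\<in>{Suc 0..j}. f (real i / real K) - f (real (i - 1) / real K)) = f (real j / real K)"
    using sum_telescope''[of 0 j "\<lambda>i. f (real i / real K)"] by (simp add: atLeastSucAtMost_greaterThanAtMost)
  finally show ?thesis
    by (simp add: j_def)
qed

lemma step_approx_error:
  assumes "continuous_on {0..1} f" "e > 0"
  obtains K where "K \<ge> 1" "\<And>t. t \<in> {0..1} \<Longrightarrow> \<bar>step_approx f K t - f t\<bar> \<le> e"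
proof -
  have "uniformly_continuous_on {0..1} f"
    using assms(1) by (intro compact_uniformly_continuous) auto
  then obtain d where d: "d > 0"
    "\<And>s t. s \<in> {0..1} \<Longrightarrow> t \<in> {0..1} \<Longrightarrow> dist t s < d \<Longrightarrow> dist (f t) (f s) < e"
    using assms(2) unfolding uniformly_continuous_on_def by metis
  obtain n where n: "inverse (real (Suc n)) < d"
    using reals_Archimedean[OF d(1)] by blast
  define K where "K = Suc n"
  have K: "real K > 0" "1 / real K < d"
    using n by (auto simp: K_def inverse_eq_divide)
  have "\<bar>step_approx f K t - f t\<bar> \<le> e" if t: "t \<in> {0..1}" for t
  proof -
    \<comment> \<open>The nearest grid point at or to the left of \<open>t\<close>, less than one
      mesh width away.\<close>
    define s where "s = real (nat \<lfloor>t * real K\<rfloor>) / real K"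
    have "t * real K \<ge> 0"
      using t K by simp
    then have "real (nat \<lfloor>t * real K\<rfloor>) \<le> t * real K" "t * real K < real (nat \<lfloor>t * real K\<rfloor>) + 1"
      by linarith+
    then have s: "0 \<le> s" "s \<le> t" "t < s + 1 / real K"
      using K by (simp_all add: s_def field_simps)
    then have "dist (f s) (f t) < e"
      using t K by (intro d(2)) (auto simp: dist_real_def)
    then show ?thesis
      using step_approx_eq[of K t f] t by (simp add: K_def[symmetric] s_def dist_real_def) (simp add: K_def)
  qed
  then show thesis
    using that[of K] by (simp add: K_def)
qed

text \<open>Finitely many values of the distribution functions determine the mean of a step
  function, so that mean converges. Each error gets \<open>e / 3\<close>: \<open>f\<close> against
  its step function in the mean, the same in the integral, and the convergence for the step
  function.\<close>

lemma cdf_imp_uniformly_distributed_system: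
  assumes pos: "\<forall>\<^sub>F N in sequentially. B N \<ge> 1"
    and unit: "\<forall>\<^sub>F N in sequentially. \<forall>j\<in>{1..B N}. v N j \<in> {0..1}"
    and cdf: "\<And>x. x \<in> {0..1} \<Longrightarrow> (\<lambda>N. empirical_cdf (B N) (v N) x) \<longlonglongrightarrow> x"
  shows "uniformly_distributed_system B v"
  unfolding uniformly_distributed_system_def
proof (intro allI impI)
  fix f :: "real \<Rightarrow> real" assume f: "continuous_on {0..1} f"
  have "(\<lambda>N. mean (B N) (v N) f) \<longlonglongrightarrow> integral {0..1} f"
  proof (rule tendstoI)
    fix e :: real assume e: "e > 0"
    then have e3: "e / 3 > 0" by simp
    obtain K where K: "K \<ge> 1" and err: "\<And>t. t \<in> {0..1} \<Longrightarrow> \<bar>step_approx f K t - f t\<bar> \<le> e / 3"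
      by (rule step_approx_error[OF f e3]) (rule that; blast)
    define a where "a i = f (real i / real K) - f (real (i - 1) / real K)" for i
    \<comment> \<open>The integral of the step function, since the indicator of
      \<open>real i / real K \<le> t\<close> has integral \<open>1 - real i / real K\<close> on
      \<open>{0..1}\<close>.\<close>
    define I where "I = f 0 + (\<Sum>i=1..K. a i * (1 - real i / real K))"
    have frac: "real i / real K \<in> {0..1}" if "i \<in> {1..K}" for i
      using that by auto
    have step: "step_approx f K = (\<lambda>t. f 0 + (\<Sum>i=1..K. a i * of_bool (real i / real K \<le> t)))"
      by (simp add: step_approx_def a_def fun_eq_iff)
    have int: "(step_approx f K has_integral I) {0..1}"
      unfolding step I_def
      using has_integral_const_real[of "f 0" 0 1] frac
      by (intro has_integral_add has_integral_sum has_integral_mult_right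
          has_integral_of_bool_atLeast) auto
    have I: "\<bar>I - integral {0..1} f\<bar> \<le> e / 3"
    proof -
      have "((\<lambda>t. step_approx f K t - f t) has_integral I - integral {0..1} f) {0..1}"
        by (intro has_integral_diff int integrable_integral integrable_continuous_real f)
      from has_integral_bound_real[OF _ _ this, of "e / 3" "{}"] show ?thesis
        using e err by simp
    qed
    have "(\<lambda>N. mean (B N) (v N) (step_approx f K)) \<longlonglongrightarrow> I"
    proof (rule Lim_transform_eventually)
      show "(\<lambda>N. f 0 + (\<Sum>i=1..K. a i * (1 - empirical_cdf (B N) (v N) (real i / real K)))) \<longlonglongrightarrow> I"
        unfolding I_def using frac by (intro tendsto_intros cdf) auto
      show "\<forall>\<^sub>F N in sequentially.
          f 0 + (\<Sum>i=1..K. a i * (1 - empirical_cdf (B N) (v N) (real i / real K)))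
            = mean (B N) (v N) (step_approx f K)"
        using pos
      proof eventually_elim
        case (elim N)
        have "1 - empirical_cdf (B N) (v N) x = mean (B N) (v N) (\<lambda>t. of_bool (x \<le> t))" for x
        proof -
          have "mean (B N) (v N) (\<lambda>t. of_bool (t < x) + of_bool (x \<le> t)) = mean (B N) (v N) (\<lambda>_. 1)"
            by (rule arg_cong[where f = "mean (B N) (v N)"]) (auto simp: fun_eq_iff)
          then show ?thesis
            using elim by (simp add: mean_add mean_const empirical_cdf_eq_mean)
        qed
        then show ?case
          using elim by (simp only: step mean_add mean_const mean_sum mean_cmult)
      qed
    qed
    then have "\<forall>\<^sub>F N in sequentially. dist (mean (B N) (v N) (step_approx f K)) I < e / 3"
      using e3 by (rule tendstoD)
    moreover have "\<forall>\<^sub>F N in sequentially.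
        \<bar>mean (B N) (v N) (step_approx f K) - mean (B N) (v N) f\<bar> \<le> e / 3"
      using pos unit by eventually_elim (intro mean_diff_le err, auto)
    ultimately show "\<forall>\<^sub>F N in sequentially. dist (mean (B N) (v N) f) (integral {0..1} f) < e"
    proof eventually_elim
      case (elim N)
      then show ?case
        using I unfolding dist_real_def by linarith
    qed
  qed
  then show "(\<lambda>N. 1 / real (B N) * (\<Sum>n=1..B N. f (v N n))) \<longlonglongrightarrow> integral {0..1} f"
    by (simp add: mean_def)
qed

section \<open>Comparison of the limit with its periodic approximants\<close>

lemma buck_density_level_sets_le:
  assumes pos: "\<forall>\<^sub>F N in sequentially. B N \<ge> 1"
    and lim: "almost_uniform_limit (\<lambda>N. periodic_extension (B N) (v N)) \<omega>"
    and e: "e > 0"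
  shows "\<forall>\<^sub>F N in sequentially. \<forall>x.
     buck_density {n \<in> {1..}. \<omega> n < x - e} \<le> empirical_cdf (B N) (v N) x + e \<and>
     buck_density {n \<in> {1..}. x + e \<le> \<omega> n} \<le> 1 - empirical_cdf (B N) (v N) x + e"
proof -
  obtain S where S: "S \<subseteq> {1..}" "buck_density S < e"
    and unif: "uniform_limit ({1..} - S) (\<lambda>N. periodic_extension (B N) (v N)) \<omega> sequentially"
    using lim e unfolding almost_uniform_limit_def buck_measurable_def by blast
  show ?thesis
    using pos uniform_limitD[OF unif e]
  proof eventually_elim
    case (elim N)
    let ?w = "periodic_extension (B N) (v N)"
    have close: "\<bar>?w n - \<omega> n\<bar> < e" if "n \<in> {1..}" "n \<notin> S" for n
      using elim(2) that by (auto simp: dist_real_def)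
    \<comment> \<open>The exceptional set \<open>S\<close> is discarded at cost \<open>e\<close>, by
      monotonicity and subadditivity.\<close>
    have split: "buck_density A \<le> buck_density C + e"
      if "A \<subseteq> C \<union> S" "C \<subseteq> {1..}" for A C
      using buck_density_mono[OF that(1)] buck_density_Un_le[OF that(2) S(1)] that(2) S by auto
    show ?case
    proof (intro allI conjI)
      fix x
      have "{n \<in> {1..}. \<omega> n < x - e} \<subseteq> {n \<in> {1..}. ?w n < x} \<union> S"
        using close by fastforce
      from split[OF this]
      show "buck_density {n \<in> {1..}. \<omega> n < x - e} \<le> empirical_cdf (B N) (v N) x + e"
        using buck_density_periodic_le[OF elim(1), of "\<lambda>t. t < x" "v N"]
        by (force simp: empirical_cdf_def)
      have "{n \<in> {1..}. x + e \<le> \<omega> n} \<subseteq> {n \<in> {1..}. x \<le> ?w n} \<union> S"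
        using close by fastforce
      from split[OF this]
      show "buck_density {n \<in> {1..}. x + e \<le> \<omega> n} \<le> 1 - empirical_cdf (B N) (v N) x + e"
        using buck_density_periodic_le[OF elim(1), of "\<lambda>t. x \<le> t" "v N"]
          empirical_cdf_complement[OF elim(1), of x "v N"] by force
    qed
  qed
qed

section \<open>Buck uniform distribution and convergence of distribution functions\<close>

lemma diff_sublevel_set: "{1..} - {n \<in> {1..}. \<omega> n < x} = {n \<in> {1..}. x \<le> \<omega> n}"
  for \<omega> :: "nat \<Rightarrow> real"
  by auto

lemma cdf_imp_buck_uniformly_distributed:
  assumes pos: "\<forall>\<^sub>F N in sequentially. B N \<ge> 1"
    and lim: "almost_uniform_limit (\<lambda>N. periodic_extension (B N) (v N)) \<omega>"
    and cdf: "\<And>x. x \<in> {0..1} \<Longrightarrow> (\<lambda>N. empirical_cdf (B N) (v N) x) \<longlonglongrightarrow> x"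
  shows "buck_uniformly_distributed \<omega>"
  unfolding buck_uniformly_distributed_def buck_measurable_def diff_sublevel_set
proof
  fix x :: real assume x: "x \<in> {0..1}"
  let ?A = "{n \<in> {1..}. \<omega> n < x}" and ?C = "{n \<in> {1..}. x \<le> \<omega> n}"
  \<comment> \<open>Convergence is given only at levels in \<open>{0..1}\<close>, but shifted levels
    may leave this interval; there \<open>0 \<le> empirical_cdf\<close> and
    \<open>empirical_cdf \<le> 1\<close> are enough.\<close>
  have up: "\<forall>\<^sub>F N in sequentially. empirical_cdf (B N) (v N) y < y + e" if "y \<ge> 0" "e > 0" for y e
  proof (cases "y \<le> 1")
    case True
    then show ?thesis
      using order_tendstoD(2)[OF cdf[of y], of "y + e"] that by simp
  next
    case False
    have "empirical_cdf (B N) (v N) y < y + e" for N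
      using empirical_cdf_le_1[of "B N" "v N" y] False that by simp
    then show ?thesis by simp
  qed
  have lo: "\<forall>\<^sub>F N in sequentially. y - e < empirical_cdf (B N) (v N) y" if "y \<le> 1" "e > 0" for y e
  proof (cases "y \<ge> 0")
    case True
    then show ?thesis
      using order_tendstoD(1)[OF cdf[of y], of "y - e"] that by simp
  next
    case False
    have "y - e < empirical_cdf (B N) (v N) y" for N
      using empirical_cdf_nonneg[of "B N" "v N" y] False that by simp
    then show ?thesis by simp
  qed
  have "buck_density ?A \<le> x"
  proof (rule field_le_epsilon)
    fix e :: real assume "e > 0"
    \<comment> \<open>One third each for the shift of the level, the convergence and the exceptional
      set. A single \<open>N\<close> suffices, as the density being bounded does not depend on
      \<open>N\<close>.\<close>
    then have e: "e / 3 > 0" by simp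
    have "x + e / 3 \<ge> 0"
      using x e by simp
    from eventually_happens'[OF sequentially_bot eventually_conj[OF up[OF this e] buck_density_level_sets_le[OF pos lim e]]]
    obtain N where N: "empirical_cdf (B N) (v N) (x + e / 3) < x + e / 3 + e / 3"
      "buck_density {n \<in> {1..}. \<omega> n < x + e / 3 - e / 3} \<le> empirical_cdf (B N) (v N) (x + e / 3) + e / 3"
      by blast
    then show "buck_density ?A \<le> x + e" by simp
  qed
  moreover have "buck_density ?C \<le> 1 - x"
  proof (rule field_le_epsilon)
    fix e :: real assume "e > 0"
    then have e: "e / 3 > 0" by simp
    have "x - e / 3 \<le> 1"
      using x e by simp
    from eventually_happens'[OF sequentially_bot eventually_conj[OF lo[OF this e] buck_density_level_sets_le[OF pos lim e]]]
    obtain N where N: "x - e / 3 - e / 3 < empirical_cdf (B N) (v N) (x - e / 3)"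
      "buck_density {n \<in> {1..}. x - e / 3 + e / 3 \<le> \<omega> n} \<le> 1 - empirical_cdf (B N) (v N) (x - e / 3) + e / 3"
      by blast
    then show "buck_density ?C \<le> 1 - x + e" by simp
  qed
  \<comment> \<open>Together with the upper bounds \<open>x\<close> and \<open>1 - x\<close> this
    forces equality in both, giving the measurability and the value of the density at once.\<close>
  moreover have "1 \<le> buck_density ?A + buck_density ?C"
    using buck_density_complement_ge[of ?A] unfolding diff_sublevel_set by blast
  ultimately show "(?A \<subseteq> {1..} \<and> buck_density ?A + buck_density ?C = 1) \<and> buck_density ?A = x"
    by auto
qed

text \<open>Here the densities of the level sets of \<omega> at \<open>x - e / 3\<close> and
  \<open>x + e / 3\<close> are known, so the comparison estimates are read as a lower and an upper
  bound for the distribution function at \<open>x\<close>.\<close>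

lemma buck_uniformly_distributed_imp_cdf:
  assumes pos: "\<forall>\<^sub>F N in sequentially. B N \<ge> 1"
    and lim: "almost_uniform_limit (\<lambda>N. periodic_extension (B N) (v N)) \<omega>"
    and ud: "buck_uniformly_distributed \<omega>"
    and x: "x \<in> {0..1}"
  shows "(\<lambda>N. empirical_cdf (B N) (v N) x) \<longlonglongrightarrow> x"
proof (rule tendstoI)
  fix e :: real assume "e > 0"
  then have e: "e / 3 > 0" by simp
  have A: "buck_density {n \<in> {1..}. \<omega> n < y} = y"
    \<comment> \<open>The complementary value comes from measurability of the sublevel set.\<close>
    and C: "buck_density {n \<in> {1..}. y \<le> \<omega> n} = 1 - y" if "y \<in> {0..1}" for y
    using ud that unfolding buck_uniformly_distributed_def buck_measurable_def diff_sublevel_set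
    by force+
  show "\<forall>\<^sub>F N in sequentially. dist (empirical_cdf (B N) (v N) x) x < e"
    using buck_density_level_sets_le[OF pos lim e]
  proof eventually_elim
    case (elim N)
    let ?F = "empirical_cdf (B N) (v N) x"
    have "x - e / 3 \<le> ?F + e / 3"
    proof (cases "x - e / 3 \<ge> 0")
      case True
      then show ?thesis
        using elim[rule_format, of x] A[of "x - e / 3"] x e by simp
    next
      \<comment> \<open>Below level 0 no information on \<omega> is used: nonnegativity of
        \<open>?F\<close> already gives the bound.\<close>
      case False
      then show ?thesis
        using empirical_cdf_nonneg[of "B N" "v N" x] e by linarith
    qed
    moreover have "1 - (x + e / 3) \<le> 1 - ?F + e / 3"
    proof (cases "x + e / 3 \<le> 1")
      case True
      then show ?thesis
        using elim[rule_format, of x] C[of "x + e / 3"] x e by simp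
    next
      case False
      then show ?thesis
        using empirical_cdf_le_1[of "B N" "v N" x] e by linarith
    qed
    ultimately show ?case
      using e by (simp add: dist_real_def abs_less_iff)
  qed
qed

theorem theorem5:
  fixes B :: "nat \<Rightarrow> nat" and v :: "nat \<Rightarrow> nat \<Rightarrow> real" and \<omega> :: "nat \<Rightarrow> real"
  assumes "\<forall>N\<ge>1. B N \<ge> 1"
    and "\<forall>N\<ge>1. \<forall>j\<in>{1..B N}. v N j \<in> {0..1}"
    and "filterlim B at_top sequentially"
    and "almost_uniform_limit (\<lambda>N. periodic_extension (B N) (v N)) \<omega>"
  shows "uniformly_distributed_system B v \<longleftrightarrow> buck_uniformly_distributed \<omega>"
proof -
  \<comment> \<open>The assumptions say nothing about \<open>N = 0\<close>, so they are passed on in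
    eventual form.\<close>
  have pos: "\<forall>\<^sub>F N in sequentially. B N \<ge> 1"
    and unit: "\<forall>\<^sub>F N in sequentially. \<forall>j\<in>{1..B N}. v N j \<in> {0..1}"
    using assms(1,2) unfolding eventually_sequentially by blast+
  show ?thesis
    using cdf_imp_buck_uniformly_distributed[OF pos assms(4) uniformly_distributed_system_imp_cdf]
      cdf_imp_uniformly_distributed_system[OF pos unit
        buck_uniformly_distributed_imp_cdf[OF pos assms(4)]]
    by blast
qed

end
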